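(* Let $n \geq 5$ be an integer and let $F_n = 2^{2^n}+1$. Then for every proper factor $d$ of $F_n$ there exists a positive integer $\lambda$ such that $d = 2^{2n+3}\lambda+1+\sqrt{(2^{2n+3}\lambda+1)^2-F_n}$ or $d = 2^{2n+3}\lambda+1-\sqrt{(2^{2n+3}\lambda+1)^2-F_n}$, and such that: (1) $(2^{2n+3}\lambda+1)^2-F_n$ is a perfect square; (2) $\lambda \in \left[\frac{-1+\sqrt{F_n}}{2^{2n+3}}, 2^{2^n-(3n+5)}\right)$; (3) $\lambda \not\equiv 0 \pmod p$ for every prime $p \equiv 3 \pmod 4$; (4) $\lambda \not\equiv 2 \pmod 4$; (5) $\lambda \equiv 1 \pmod 3$.
   Context: A proper factor of $F_n$ is a positive divisor $d$ of $F_n$ with $1<d<F_n$. A perfect square is the square of an integer. *)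

theory Defs
  imports Complex_Main "HOL-Number_Theory.Number_Theory"
    "HOL-Computational_Algebra.Nth_Powers"
begin

definition fermat_number :: "nat \<Rightarrow> nat" where
  "fermat_number n = 2 ^ (2 ^ n) + 1"

definition proper_factor :: "nat \<Rightarrow> nat \<Rightarrow> bool" where
  "proper_factor d m \<longleftrightarrow> d dvd m \<and> 1 < d \<and> d < m"

end

theory Submission
  imports Defs
begin

text \<open>
  Write $F_n = d e$ and let $\lambda$ be determined by $d + e = 2 X$ with
  $X = 2^{2n+3}\lambda + 1$. Then $d$ and $e$ are the roots of $t^2 - 2Xt + F_n$, so they are
  $X \pm y$ where $y = (d - e)/2$ satisfies $y^2 = X^2 - F_n$. Everything else rests on
  two points.

  First, $\lambda$ is an integer. By the theorem of Euler and Lucas every divisor of $F_n$ is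
  $1$ modulo $M = 2^{n+2}$ (\<open>fermat_divisor_cong_1\<close>). With $d = Ma + 1$ and $e = Mb + 1$ the
  product becomes $M^2 ab + M(a + b) = 2^{2^n}$, and since $M^2$ divides the right-hand side,
  $M$ divides $a + b$; the quotient is $\lambda$ (\<open>fermat_factor_pair\<close>). The same
  equation gives the upper bound, because $a + b \le ab + 1$ for $a, b \ge 1$; the lower
  bound only says that $X^2 - F_n$ is nonnegative.

  Second, the congruences for $\lambda$ follow from the single equation
  $y^2 + 2^{2^n} = 2^{2n+4}\lambda(2^{2n+2}\lambda + 1)$. A prime dividing $\lambda$ and
  congruent to $3$ modulo $4$ would divide the sum of two squares on the left, which are
  prime to it. If $\lambda$ were twice an odd number, the exact power of $2$ in $y^2$ would
  be $2^{2n+5}$, with odd exponent. Modulo $3$, only $\lambda \equiv 1$ makes $y^2$ a square.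

  Both the theorem of Euler and Lucas and the fact on sums of two squares are instances of
  \<open>odd_prime_dvd_sum_two_powers\<close>.
\<close>

section \<open>Divisors of Fermat numbers\<close>

text \<open>
  If $2^{k+1}$ did not divide $p - 1$, some odd $m$ would make $2^k m$ a multiple of $p - 1$.
  The odd power $m$ preserves the sign in $a^{2^k} \equiv -b^{2^k}$, so Fermat's little theorem
  would yield $1 \equiv -1$ modulo $p$.
\<close>
lemma odd_prime_dvd_sum_two_powers:
  fixes a b :: int and p k :: nat
  assumes p: "prime p" "odd p"
    and dvd: "int p dvd a ^ (2 ^ k) + b ^ (2 ^ k)"
    and a: "\<not> int p dvd a"
  shows "2 ^ (k + 1) dvd p - 1"
proof (rule ccontr)
  assume nd: "\<not> 2 ^ (k + 1) dvd p - 1"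
  have pi: "prime (int p)" using p by simp
  have b: "\<not> int p dvd b"
  proof
    assume "int p dvd b"
    hence "int p dvd b ^ (2 ^ k)"
      by (simp add: dvd_power_le[of "int p" b 1 "2 ^ k", simplified])
    hence "int p dvd a ^ (2 ^ k)" using dvd by (simp add: dvd_add_left_iff)
    thus False using a pi prime_dvd_power by blast
  qed
  have "p - 1 \<noteq> 0" using prime_gt_1_nat[OF p(1)] by simp
  then obtain j m where m: "p - 1 = 2 ^ j * m" "odd m"
    by (rule multiplicity_decompose'[of "p - 1" 2]) auto
  have "j \<le> k"
  proof (rule ccontr)
    assume "\<not> j \<le> k"
    hence "2 ^ (k + 1) dvd (2 :: nat) ^ j" by (intro le_imp_power_dvd) simp
    thus False using nd m by (metis dvd_mult2)
  qed
  hence "(2::nat) ^ k = 2 ^ j * 2 ^ (k - j)" by (simp flip: power_add)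
  hence e: "2 ^ k * m = (p - 1) * 2 ^ (k - j)" unfolding m(1) by (simp only: mult_ac)
  have fermat: "[c ^ (2 ^ k * m) = 1] (mod int p)" if c: "\<not> int p dvd c" for c :: int
  proof -
    have "\<not> p dvd nat (c mod int p)"
      using c prime_gt_0_nat[OF p(1)] by (simp add: int_dvd_int_iff[symmetric] dvd_mod_iff)
    hence "[nat (c mod int p) ^ (p - 1) = 1] (mod p)" by (rule fermat_theorem[OF p(1)])
    hence "[int (nat (c mod int p) ^ (p - 1)) = int 1] (mod int p)"
      by (simp only: cong_int_iff)
    hence "[(c mod int p) ^ (p - 1) = 1] (mod int p)"
      using prime_gt_0_nat[OF p(1)] by simp
    hence "[c ^ (p - 1) = 1] (mod int p)" by (simp add: cong_def power_mod)
    hence "[(c ^ (p - 1)) ^ 2 ^ (k - j) = 1 ^ 2 ^ (k - j)] (mod int p)" by (rule cong_pow)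
    thus ?thesis by (simp only: e power_mult power_one)
  qed
  have "[a ^ 2 ^ k = - (b ^ 2 ^ k)] (mod int p)" using dvd by (simp add: cong_iff_dvd_diff)
  hence "[(a ^ 2 ^ k) ^ m = (- (b ^ 2 ^ k)) ^ m] (mod int p)" by (rule cong_pow)
  hence "[a ^ (2 ^ k * m) = - (b ^ (2 ^ k * m))] (mod int p)"
    using m(2) by (simp add: power_mult power_minus_odd)
  hence "int p dvd a ^ (2 ^ k * m) + b ^ (2 ^ k * m)" by (simp add: cong_iff_dvd_diff)
  moreover have "[a ^ (2 ^ k * m) + b ^ (2 ^ k * m) = 1 + 1] (mod int p)"
    by (intro cong_add fermat a b)
  ultimately have "int p dvd 2" using cong_dvd_iff by fastforce
  hence "p dvd 2" using int_dvd_int_iff[of p 2] by simp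
  hence "p = 2" using p(1) by (simp add: primes_dvd_imp_eq)
  thus False using p(2) by simp
qed

text \<open>
  The square root of $2$ modulo $F_n$ is what improves Euler's modulus $2^{n+1}$ to Lucas's
  $2^{n+2}$: with $u = 2^{2^{n-2}}$ we have $F_n = u^4 + 1$, and $s = u (u^2 - 1)$ satisfies
  $s^2 = u^6 - 2u^4 + u^2 \equiv 2$. Hence $s^{2^{n+1}} \equiv 2^{2^n} \equiv -1$.
\<close>
lemma fermat_prime_divisor:
  assumes n: "n \<ge> 2" and p: "prime p" "p dvd fermat_number n"
  shows "2 ^ (n + 2) dvd p - 1"
proof -
  define u s :: int where "u = 2 ^ (2 ^ (n - 2))" and "s = u * (u\<^sup>2 - 1)"
  have "(2::nat) ^ n = 2 ^ (n - 2) * 4"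
    using n by (cases n; cases "n - 1") auto
  hence F: "int (fermat_number n) = u ^ 4 + 1"
    by (simp add: fermat_number_def u_def power_mult[symmetric])
  have F': "int (fermat_number n) = 2 ^ (2 ^ n) + 1" by (simp add: fermat_number_def)
  have pF: "int p dvd int (fermat_number n)" using p(2) by simp
  have odd: "odd p"
  proof
    assume "even p"
    hence "even (fermat_number n)" using p(2) dvd_trans by blast
    thus False by (simp add: fermat_number_def)
  qed
  have "s\<^sup>2 - 2 = (u ^ 4 + 1) * (u\<^sup>2 - 2)"
    by (simp add: s_def power2_eq_square power4_eq_xxxx algebra_simps)
  hence "[s\<^sup>2 = 2] (mod int p)" using pF F by (simp add: cong_iff_dvd_diff)
  hence "[(s\<^sup>2) ^ 2 ^ n = 2 ^ 2 ^ n] (mod int p)" by (rule cong_pow)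
  hence "[s ^ 2 ^ (n + 1) = 2 ^ 2 ^ n] (mod int p)" by (simp add: power_mult[symmetric])
  hence "[s ^ 2 ^ (n + 1) + 1 ^ 2 ^ (n + 1) = int (fermat_number n)] (mod int p)"
    unfolding F' by (intro cong_add) simp_all
  hence dvd: "int p dvd s ^ 2 ^ (n + 1) + 1 ^ 2 ^ (n + 1)"
    using pF cong_dvd_iff by blast
  have "\<not> int p dvd s"
  proof
    assume "int p dvd s"
    hence "int p dvd s ^ 2 ^ (n + 1)"
      by (simp add: dvd_power_le[of "int p" s 1 "2 ^ (n + 1)", simplified])
    hence "int p dvd 1" using dvd by (simp add: dvd_add_right_iff)
    thus False using p(1) by auto
  qed
  from odd_prime_dvd_sum_two_powers[OF p(1) odd dvd this] show ?thesis by simp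
qed

lemma cong_1_if_prime_divisors_cong_1:
  fixes d m :: nat
  assumes "d > 0" "\<And>p. prime p \<Longrightarrow> p dvd d \<Longrightarrow> [p = 1] (mod m)"
  shows "[d = 1] (mod m)"
  using assms
proof (induction d rule: prime_divisors_induct)
  case (factor p x)
  have "[p * x = 1 * 1] (mod m)"
    by (intro cong_mult factor.IH factor.prems(2)) (use factor in auto)
  thus ?case by simp
qed auto

corollary fermat_divisor_cong_1:
  assumes "n \<ge> 2" "d dvd fermat_number n"
  shows "[d = 1] (mod 2 ^ (n + 2))"
proof (rule cong_1_if_prime_divisors_cong_1)
  show "d > 0" using assms(2) by (intro Nat.gr0I) (auto simp: fermat_number_def)
next
  fix p assume p: "prime p" "p dvd d"
  hence "2 ^ (n + 2) dvd p - 1" using assms fermat_prime_divisor dvd_trans by blast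
  thus "[p = 1] (mod 2 ^ (n + 2))"
    using prime_ge_1_nat[OF p(1)] by (simp add: cong_altdef_nat)
qed

section \<open>The half-sum of a pair of complementary divisors\<close>

text \<open>
  The first hypothesis makes $2^{2n+4}$ divide $2^{2^n}$, which turns the two congruences
  modulo $2^{n+2}$ for the complementary divisors into divisibility of $a + b$ by $2^{n+2}$.
\<close>
lemma fermat_factor_pair:
  assumes n: "2 * n + 4 \<le> 2 ^ n" "n \<ge> 2" and d: "proper_factor d (fermat_number n)"
  obtains a b l :: nat where
    "d = 2 ^ (n + 2) * a + 1"
    "a + b = 2 ^ (n + 2) * l"
    "fermat_number n = (2 ^ (n + 2) * a + 1) * (2 ^ (n + 2) * b + 1)"
    "l > 0" "2 ^ (3 * n + 6) * l \<le> 2 ^ 2 ^ n"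
proof -
  define M :: nat where "M = 2 ^ (n + 2)"
  have Mpos: "M > 0" by (simp add: M_def)
  from d obtain e where e: "fermat_number n = d * e" and d1: "1 < d" and dF: "d < fermat_number n"
    by (auto simp: proper_factor_def)
  have e1: "1 < e" using e dF d1 by (cases "e = 0"; cases "e = 1") auto
  have shape: "\<exists>c. x = M * c + 1" if "x dvd fermat_number n" "x > 1" for x
  proof -
    have "[x = 1] (mod M)" using fermat_divisor_cong_1[OF n(2) that(1)] by (simp add: M_def)
    hence "M dvd x - 1" using that(2) by (simp add: cong_altdef_nat)
    thus ?thesis using that(2) by (metis dvd_def le_add_diff_inverse2 less_imp_le)
  qed
  obtain a where a: "d = M * a + 1" using shape[of d] e d1 by auto
  obtain b where b: "e = M * b + 1" using shape[of e] e e1 by auto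
  have ab: "a \<ge> 1" "b \<ge> 1" using a b d1 e1 by (auto simp: Suc_le_eq intro!: Nat.gr0I)
  have M2: "M\<^sup>2 = 2 ^ (2 * n + 4)"
    unfolding M_def power_mult[symmetric] by (rule arg_cong[of _ _ "power 2"]) simp
  have eq: "M\<^sup>2 * (a * b) + M * (a + b) = 2 ^ 2 ^ n"
  proof -
    have "(M * a + 1) * (M * b + 1) = 2 ^ 2 ^ n + 1"
      using e a b by (simp add: fermat_number_def)
    thus ?thesis by (simp add: algebra_simps power2_eq_square)
  qed
  have "M\<^sup>2 dvd 2 ^ 2 ^ n" unfolding M2 by (intro le_imp_power_dvd n)
  hence "M\<^sup>2 dvd M * (a + b)" unfolding eq[symmetric] by (simp only: dvd_add_right_iff dvd_triv_left)
  hence "M dvd a + b" using Mpos by (simp add: power2_eq_square)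
  then obtain l where l: "a + b = M * l" by (auto simp: dvd_def)
  have l0: "l > 0" using l ab by (intro Nat.gr0I) auto
  \<comment> \<open>This is $(a - 1)(b - 1) \ge 0$; multiplied by $M^2$, it bounds $\lambda$ through \<open>eq\<close>.\<close>
  have "M * l \<le> a * b + 1"
  proof -
    obtain a' b' where "a = Suc a'" "b = Suc b'" using ab by (metis Suc_le_D One_nat_def)
    thus ?thesis using l by simp
  qed
  hence "M\<^sup>2 * (M * l) \<le> M\<^sup>2 * (a * b) + M\<^sup>2" by (metis mult_le_mono2 distrib_left mult.right_neutral)
  also have "\<dots> \<le> M\<^sup>2 * (a * b) + M * (a + b)"
    unfolding l using l0 by (simp add: power2_eq_square)
  also have "\<dots> = 2 ^ 2 ^ n" by (rule eq)
  also have "M\<^sup>2 * (M * l) = 2 ^ (3 * n + 6) * l"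
  proof -
    have "M\<^sup>2 * M = 2 ^ (3 * n + 6)"
      unfolding M2 unfolding M_def power_add[symmetric]
      by (rule arg_cong[of _ _ "power 2"]) simp
    thus ?thesis by (metis mult.assoc)
  qed
  finally show ?thesis
    using that[of a b l] a b e l l0 by (simp add: M_def)
qed

section \<open>Congruence conditions on the coefficient $\lambda$ in the half-sum\<close>

text \<open>
  Since $2^{2^n}$ is a square $z^2$, the equation makes $z^2 + y^2$ a multiple of $\lambda$,
  and a prime $p \equiv 3$ modulo $4$ that divides a sum of two squares divides both of them;
  but $z$ is a power of $2$.
\<close>
lemma prime_3_mod_4_not_dvd_half_sum_coeff:
  fixes y l :: int
  assumes n: "n \<ge> 1" and sq: "y\<^sup>2 = (2 ^ (2 * n + 3) * l + 1)\<^sup>2 - int (fermat_number n)"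
    and p: "prime p" "[p = 3] (mod 4)"
  shows "\<not> int p dvd l"
proof
  assume pl: "int p dvd l"
  have odd: "odd p"
  proof
    assume "even p"
    hence "even (p mod 4)" by (simp add: dvd_mod)
    thus False using p(2) by (simp add: cong_def)
  qed
  define z :: int where "z = 2 ^ 2 ^ (n - 1)"
  have "(2::nat) ^ n = 2 ^ (n - 1) * 2" using n by (cases n) auto
  hence z: "z\<^sup>2 = 2 ^ 2 ^ n" by (simp add: z_def power_mult)
  define A :: int where "A = 2 ^ (2 * n + 3)"
  have "z\<^sup>2 + y\<^sup>2 = l * (A * (A * l + 2))"
    unfolding sq z A_def[symmetric] fermat_number_def
    by (simp add: power2_eq_square algebra_simps)
  hence "int p dvd z ^ 2 ^ 1 + y ^ 2 ^ 1" using pl by simp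
  moreover have "\<not> int p dvd z"
  proof
    assume "int p dvd z"
    hence "int p dvd 2" unfolding z_def using p(1) prime_dvd_power by (metis prime_nat_int_transfer)
    hence "p dvd 2" using int_dvd_int_iff[of p 2] by simp
    thus False using p(1) odd primes_dvd_imp_eq two_is_prime_nat by blast
  qed
  ultimately have "2 ^ (1 + 1) dvd p - 1" by (intro odd_prime_dvd_sum_two_powers p odd)
  hence "4 dvd p - 1" by simp
  thus False using p(2) prime_ge_1_nat[OF p(1)] unfolding cong_def by presburger
qed

lemma odd_power_2_times_odd_not_square:
  fixes y r :: int
  assumes "y\<^sup>2 = 2 ^ j * r" "odd r"
  shows "even j"
proof -
  have "y \<noteq> 0" using assms by auto
  hence "multiplicity 2 (y\<^sup>2) = 2 * multiplicity 2 y"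
    by (intro prime_elem_multiplicity_power_distrib) auto
  moreover have "multiplicity 2 (2 ^ j * r) = j"
    by (intro multiplicity_eqI) (use assms in auto)
  ultimately show ?thesis using assms by simp
qed

text \<open>
  For $\lambda = 2m$ with $m$ odd, $y^2 = 2^{2n+5} m (2^{2n+3}m + 1) - 2^{2^n}$. The hypothesis
  on $n$ makes the last term divisible by $2^{2n+6}$, so it does not affect the exact power
  of $2$ in $y^2$.
\<close>
lemma half_sum_coeff_not_2_mod_4:
  fixes y l :: int
  assumes n: "2 * n + 6 \<le> 2 ^ n"
    and sq: "y\<^sup>2 = (2 ^ (2 * n + 3) * l + 1)\<^sup>2 - int (fermat_number n)"
  shows "\<not> [l = 2] (mod 4)"
proof
  assume "[l = 2] (mod 4)"
  hence "l mod 4 = 2" by (simp add: cong_def)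
  hence "l = 2 * (2 * (l div 4) + 1)" by presburger
  then obtain m where m: "l = 2 * m" "odd m" by fastforce
  define B :: int where "B = 2 ^ (2 * n + 2)"
  have "(2::nat) ^ n = (2 * n + 5) + (2 ^ n - (2 * n + 5))" using n by simp
  hence F: "(2::int) ^ 2 ^ n = 2 ^ (2 * n + 5) * 2 ^ (2 ^ n - (2 * n + 5))"
    by (metis power_add)
  have pw: "(2::int) ^ (2 * n + 5) = 8 * B" "(2::int) ^ (2 * n + 3) = 2 * B"
    by (simp_all add: B_def power_add)
  have "y\<^sup>2 = 2 ^ (2 * n + 5) * (m * (2 * B * m + 1) - 2 ^ (2 ^ n - (2 * n + 5)))"
    unfolding sq right_diff_distrib F[symmetric] fermat_number_def
    unfolding pw m by (simp add: power2_eq_square algebra_simps)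
  moreover have "odd (m * (2 * B * m + 1) - 2 ^ (2 ^ n - (2 * n + 5)))"
    using m n by simp
  ultimately have "even (2 * n + 5)" by (rule odd_power_2_times_odd_not_square)
  thus False by simp
qed

text \<open>Modulo $3$ the equation reads $y^2 \equiv (2\lambda + 1)^2 - 2$.\<close>
lemma half_sum_coeff_1_mod_3:
  fixes y l :: int
  assumes n: "n \<ge> 1" and sq: "y\<^sup>2 = (2 ^ (2 * n + 3) * l + 1)\<^sup>2 - int (fermat_number n)"
  shows "[l = 1] (mod 3)"
proof -
  have four: "[4 ^ k = 1] (mod 3 :: int)" for k
    using cong_pow[of 4 1 "3::int" k] by (simp add: cong_def)
  have "(2::nat) ^ n = 2 * 2 ^ (n - 1)" using n by (cases n) auto
  hence "(2::int) ^ 2 ^ n = 4 ^ 2 ^ (n - 1)" by (simp add: power_mult)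
  hence F: "[int (fermat_number n) = 1 + 1] (mod 3)"
    using cong_add[OF four[of "2 ^ (n - 1)"] cong_refl[of 1]]
    by (simp add: fermat_number_def add.commute)
  have "(2::int) ^ (2 * n + 3) = 4 ^ n * 8" by (simp add: power_add power_mult)
  moreover have "[4 ^ n * 8 = 1 * 2] (mod 3 :: int)"
    by (intro cong_mult four) (simp add: cong_def)
  ultimately have "[2 ^ (2 * n + 3) = 2] (mod 3 :: int)" by simp
  hence "[(2 ^ (2 * n + 3) * l + 1)\<^sup>2 - int (fermat_number n) = (2 * l + 1)\<^sup>2 - 2] (mod 3)"
    using F by (intro cong_diff cong_pow cong_add cong_mult) auto
  also have "[(2 * l + 1)\<^sup>2 - 2 = (2 * (l mod 3) + 1)\<^sup>2 - 2] (mod 3)"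
    by (intro cong_diff cong_pow cong_add cong_mult) (auto simp: cong_def)
  finally have "[y\<^sup>2 = (2 * (l mod 3) + 1)\<^sup>2 - 2] (mod 3)" using sq by simp
  moreover have "[y\<^sup>2 = (y mod 3)\<^sup>2] (mod 3)" by (simp add: cong_def power_mod)
  ultimately have "[(y mod 3)\<^sup>2 = (2 * (l mod 3) + 1)\<^sup>2 - 2] (mod 3)"
    using cong_sym cong_trans by blast
  moreover have "y mod 3 \<in> {0, 1, 2}" "l mod 3 \<in> {0, 1, 2}" by auto
  ultimately show ?thesis by (auto simp: cong_def)
qed

section \<open>Fermat factors as roots of a quadratic\<close>

theorem theorem3p3:
  fixes n :: nat
  assumes "n \<ge> 5"
  shows "\<forall>d::nat. proper_factor d (fermat_number n) \<longrightarrow>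
    (\<exists>l::nat. l > 0 \<and>
      (real d = 2 ^ (2 * n + 3) * real l + 1
          + sqrt ((2 ^ (2 * n + 3) * real l + 1)\<^sup>2 - real (fermat_number n)) \<or>
       real d = 2 ^ (2 * n + 3) * real l + 1
          - sqrt ((2 ^ (2 * n + 3) * real l + 1)\<^sup>2 - real (fermat_number n))) \<and>
      is_square ((2 ^ (2 * n + 3) * int l + 1)\<^sup>2 - int (fermat_number n)) \<and>
      real l \<in> {(- 1 + sqrt (real (fermat_number n))) / 2 ^ (2 * n + 3)
                 ..< 2 powi (2 ^ n - (3 * int n + 5))} \<and>
      (\<forall>p::nat. prime p \<and> [p = 3] (mod 4) \<longrightarrow> \<not> [l = 0] (mod p)) \<and>
      \<not> [l = 2] (mod 4) \<and>
      [l = 1] (mod 3))"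
proof (intro allI impI)
  fix d assume d: "proper_factor d (fermat_number n)"
  have n6: "2 * n + 6 \<le> 2 ^ n"
    using assms
  proof (induction n rule: dec_induct)
    case (step k)
    thus ?case by simp
  qed simp
  obtain a b l :: nat where a: "d = 2 ^ (n + 2) * a + 1"
    and l: "a + b = 2 ^ (n + 2) * l"
    and F: "fermat_number n = (2 ^ (n + 2) * a + 1) * (2 ^ (n + 2) * b + 1)"
    and l0: "l > 0" and bound: "2 ^ (3 * n + 6) * l \<le> 2 ^ 2 ^ n"
    using fermat_factor_pair[OF _ _ d] n6 assms by (auto simp del: power_Suc)
  define N where "N = (2::int) ^ (n + 1)"
  \<comment> \<open>\<open>X\<close> and \<open>y\<close> are the half-sum and half-difference of \<open>d\<close> and its cofactor.\<close>
  define X where "X = 2 ^ (2 * n + 3) * int l + 1"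
  define y where "y = N * (int a - int b)"
  have M: "(2::int) ^ (n + 2) = 2 * N" by (simp add: N_def)
  have "2 ^ (2 * n + 3) = N * 2 ^ (n + 2)"
    unfolding N_def power_add[symmetric] by (rule arg_cong[of _ _ "power 2"]) simp
  moreover have lint: "2 ^ (n + 2) * int l = int a + int b"
    using arg_cong[OF l, of int] by simp
  ultimately have X: "X = N * (int a + int b) + 1" unfolding X_def by (metis mult.assoc)
  have Fint: "int (fermat_number n) = (2 * N * int a + 1) * (2 * N * int b + 1)"
    unfolding F of_nat_mult of_nat_add of_nat_power of_nat_numeral of_nat_1 M by (rule refl)
  have sq: "y\<^sup>2 = X\<^sup>2 - int (fermat_number n)"
    unfolding X Fint y_def by (simp add: power2_eq_square algebra_simps)
  have dXy: "int d = X + y" unfolding X y_def a using M by (simp add: algebra_simps)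
  have Xr: "2 ^ (2 * n + 3) * real l + 1 = real_of_int X" by (simp add: X_def)
  have sqr: "(real_of_int X)\<^sup>2 - real (fermat_number n) = (real_of_int y)\<^sup>2"
    using arg_cong[OF sq, of real_of_int] by simp
  have dr: "real d = real_of_int X + real_of_int y"
    using arg_cong[OF dXy, of real_of_int] by simp
  have root: "real d = real_of_int X + sqrt ((real_of_int X)\<^sup>2 - real (fermat_number n)) \<or>
      real d = real_of_int X - sqrt ((real_of_int X)\<^sup>2 - real (fermat_number n))"
    unfolding sqr dr real_sqrt_abs by linarith
  have "real (fermat_number n) \<le> (real_of_int X)\<^sup>2"
    using sqr zero_le_power2[of "real_of_int y"] by linarith
  moreover have "real_of_int X \<ge> 0" by (simp add: X_def)
  ultimately have "sqrt (real (fermat_number n)) \<le> real_of_int X"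
    by (simp add: real_le_lsqrt)
  hence lower: "(- 1 + sqrt (real (fermat_number n))) / 2 ^ (2 * n + 3) \<le> real l"
    unfolding Xr[symmetric] by (simp add: divide_le_eq mult.commute)
  have upper: "real l < 2 powi (2 ^ n - (3 * int n + 5))"
  proof -
    have "2 ^ (3 * n + 5) * l < 2 ^ (3 * n + 6) * l" using l0 by simp
    hence "2 ^ (3 * n + 5) * l < 2 ^ 2 ^ n" using bound by (rule less_le_trans)
    hence "real (2 ^ (3 * n + 5) * l) < real (2 ^ 2 ^ n)" by (simp only: of_nat_less_iff)
    hence "real l < 2 ^ 2 ^ n / 2 ^ (3 * n + 5)" by (simp add: less_divide_eq mult.commute)
    also have "\<dots> = 2 powi int (2 ^ n) / 2 powi int (3 * n + 5)" by (simp only: power_int_of_nat)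
    also have "\<dots> = 2 powi (int (2 ^ n) - int (3 * n + 5))" by (rule power_int_diff[symmetric]) simp
    finally show ?thesis by simp
  qed
  have sq': "y\<^sup>2 = (2 ^ (2 * n + 3) * int l + 1)\<^sup>2 - int (fermat_number n)"
    using sq by (simp only: X_def)
  have primes: "\<not> [l = 0] (mod p)" if "prime p" "[p = 3] (mod 4)" for p
    using prime_3_mod_4_not_dvd_half_sum_coeff[OF _ sq' that] assms by (simp add: cong_0_iff)
  have mod4: "\<not> [l = 2] (mod 4)"
    using half_sum_coeff_not_2_mod_4[OF n6 sq'] cong_int_iff[of l 2 4] by simp
  have mod3: "[l = 1] (mod 3)"
    using half_sum_coeff_1_mod_3[OF _ sq'] assms cong_int_iff[of l 1 3] by simp
  have square: "is_square ((2 ^ (2 * n + 3) * int l + 1)\<^sup>2 - int (fermat_number n))"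
    unfolding sq'[symmetric] by simp
  show "\<exists>l::nat. l > 0 \<and>
      (real d = 2 ^ (2 * n + 3) * real l + 1
          + sqrt ((2 ^ (2 * n + 3) * real l + 1)\<^sup>2 - real (fermat_number n)) \<or>
       real d = 2 ^ (2 * n + 3) * real l + 1
          - sqrt ((2 ^ (2 * n + 3) * real l + 1)\<^sup>2 - real (fermat_number n))) \<and>
      is_square ((2 ^ (2 * n + 3) * int l + 1)\<^sup>2 - int (fermat_number n)) \<and>
      real l \<in> {(- 1 + sqrt (real (fermat_number n))) / 2 ^ (2 * n + 3)
                 ..< 2 powi (2 ^ n - (3 * int n + 5))} \<and>
      (\<forall>p::nat. prime p \<and> [p = 3] (mod 4) \<longrightarrow> \<not> [l = 0] (mod p)) \<and>
      \<not> [l = 2] (mod 4) \<and>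
      [l = 1] (mod 3)"
    using l0 root square lower upper primes mod4 mod3 unfolding Xr[symmetric]
    by (intro exI[of _ l] conjI) auto
qed

end
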